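(* Let $a\in(0,1]$ be known and let $$\widehat F_m=\arg\min_{H\in\mathcal F}\bigl\|\widehat G-(1-a)U-aH\bigr\|_\infty .$$ Then $$\|F-\widehat F_m\|_\infty\le\frac{2\,\|G-\widehat G\|_\infty}{a}\xrightarrow{\text{a.s.}}0\qquad(m\to\infty).$$
   Context: Model: $P_1,P_2,\dots$ are i.i.d. with distribution function $G(t)=(1-a)t+aF(t)$ on $[0,1]$, with density $g=G'$. Here $\mathcal F$ is a class of distribution functions $H$ on $[0,1]$ with $H(t)\ge t$ for all $t$, $F\in\mathcal F$, and $U(t)=t$ is the Uniform$(0,1)$ distribution function. $\|K\|_\infty=\sup_{0\le t\le1}|K(t)|$. $\widehat F_m$ is any minimizer (assumed to exist). $\widehat G$ is the estimator of $G$ given by $\widehat G(t)=\max\{\mathbb G_m(t),t\}$, where $\mathbb G_m$ is the empirical distribution function of $P_1,\dots,P_m$, or, when $G$ is assumed concave, by the same formula with $\mathbb G_m$ replaced by its least concave majorant (the infimum of all concave distribution functions lying above $\mathbb G_m$). *)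

theory Defs
  imports "HOL-Probability.Probability"
begin

(* Mass at the point 0 is allowed; off [0,1] such a function is 0 on the left and 1 on the right. *)
definition unit_cdf :: "(real \<Rightarrow> real) \<Rightarrow> bool" where
  "unit_cdf H \<longleftrightarrow> (\<exists>\<mu>. real_distribution \<mu> \<and> measure \<mu> {0..1} = 1 \<and> H = cdf \<mu>)"

(* Meant for functions bounded on [0,1]; on unbounded ones the real supremum is unspecified. *)
definition unit_supnorm :: "(real \<Rightarrow> real) \<Rightarrow> real" where
  "unit_supnorm K = (SUP t\<in>{0..1}. \<bar>K t\<bar>)"

definition empirical_cdf :: "nat \<Rightarrow> (nat \<Rightarrow> real) \<Rightarrow> real \<Rightarrow> real" where
  "empirical_cdf m x t = real (card {i \<in> {1..m}. x i \<le> t}) / real m"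

(* For K at most 1 on [0,1] the infimum ranges over a nonempty set, as the distribution
   function of the point mass at 0 is concave on [0,1] and lies above K. *)
definition least_concave_majorant :: "(real \<Rightarrow> real) \<Rightarrow> real \<Rightarrow> real" where
  "least_concave_majorant K t =
     (INF H\<in>{H. unit_cdf H \<and> concave_on {0..1} H \<and> (\<forall>s\<in>{0..1}. K s \<le> H s)}. H t)"

definition G_hat :: "(nat \<Rightarrow> 'a \<Rightarrow> real) \<Rightarrow> nat \<Rightarrow> 'a \<Rightarrow> real \<Rightarrow> real" where
  "G_hat P m \<omega> t = max (empirical_cdf m (\<lambda>i. P i \<omega>) t) t"

definition G_hat_concave :: "(nat \<Rightarrow> 'a \<Rightarrow> real) \<Rightarrow> nat \<Rightarrow> 'a \<Rightarrow> real \<Rightarrow> real" where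
  "G_hat_concave P m \<omega> t = max (least_concave_majorant (empirical_cdf m (\<lambda>i. P i \<omega>)) t) t"

end

theory Submission imports Defs begin

text \<open>
The inequality is the triangle inequality for a projection. Since \<open>G = (1 - a) U + a F\<close> with
\<open>F \<in> \<F>\<close>, the criterion that \<open>Fhat\<close> minimises takes the value
\<open>d = \<parallel>Ghat - G\<parallel>\<close> at \<open>F\<close>, so it is at most \<open>d\<close> at \<open>Fhat\<close>. Hence
\<open>a (F - Fhat) = (G - Ghat) + (Ghat - (1 - a) U - a Fhat)\<close> is a sum of two functions of
supremum norm at most \<open>d\<close>.

The convergence \<open>d \<rightarrow> 0\<close> splits into a deterministic and a probabilistic half.

The deterministic half says that neither way of building \<open>Ghat\<close> increases the distance of the
empirical distribution function from \<open>G\<close>. Taking the maximum with the identity is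
nonexpansive and leaves \<open>G\<close> fixed, because every \<open>H \<in> \<F>\<close> and hence \<open>G\<close> lies above the
identity. For the least concave majorant this is Marshall's lemma
(\<open>least_concave_majorant_close\<close>).

The probabilistic half is the Glivenko-Cantelli theorem for a continuous distribution function
(\<open>glivenko_cantelli_unit\<close>); continuity holds because the \<open>P i\<close> have densities
(\<open>isCont_cdf_of_density\<close>). At a fixed
point, the empirical distribution function is an average of independent variables with values in
the unit interval, so Hoeffding's exponential tail bound is summable and the Borel-Cantelli lemma
gives almost sure convergence (\<open>bounded_strong_law\<close>). This holds simultaneously at all
rational points, and monotonicity together with continuity of the limit makes it uniform
(\<open>uniform_limit_monotone_on_unit\<close>).
\<close>

section \<open>The supremum norm on the unit interval\<close>

lemma unit_supnorm_le:
  assumes "\<And>t. t \<in> {0..1} \<Longrightarrow> \<bar>K t\<bar> \<le> c"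
  shows "unit_supnorm K \<le> c"
  unfolding unit_supnorm_def using assms by (intro cSUP_least) auto

lemma abs_le_unit_supnorm:
  assumes "\<And>s. s \<in> {0..1} \<Longrightarrow> \<bar>K s\<bar> \<le> c" and "t \<in> {0..1}"
  shows "\<bar>K t\<bar> \<le> unit_supnorm K"
  unfolding unit_supnorm_def using assms by (intro cSUP_upper bdd_aboveI2) auto

lemma unit_supnorm_tendsto_0:
  assumes "uniform_limit {0..1} f l F"
  shows "((\<lambda>n. unit_supnorm (\<lambda>t. l t - f n t)) \<longlongrightarrow> 0) F"
proof (rule tendstoI)
  fix e :: real assume "e > 0"
  hence "e / 2 > 0" by simp
  with assms have "\<forall>\<^sub>F n in F. \<forall>t\<in>{0..1}. dist (f n t) (l t) < e / 2"
    by (rule uniform_limitD)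
  thus "\<forall>\<^sub>F n in F. dist (unit_supnorm (\<lambda>t. l t - f n t)) 0 < e"
  proof eventually_elim
    case (elim n)
    have le: "\<bar>l t - f n t\<bar> \<le> e / 2" if "t \<in> {0..1}" for t
      using bspec[OF elim that] unfolding dist_real_def by linarith
    have "unit_supnorm (\<lambda>t. l t - f n t) \<le> e / 2"
      using le by (rule unit_supnorm_le)
    moreover have "\<bar>l 0 - f n 0\<bar> \<le> unit_supnorm (\<lambda>t. l t - f n t)"
      using le by (rule abs_le_unit_supnorm) auto
    ultimately show ?case
      using \<open>e > 0\<close> by (simp add: dist_real_def)
  qed
qed

section \<open>Distribution functions on the unit interval\<close>

lemma unit_cdf_bounds:
  assumes "unit_cdf H"
  shows "0 \<le> H t" "H t \<le> 1"
proof -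
  obtain \<mu> where "real_distribution \<mu>" and H: "H = cdf \<mu>"
    using assms by (auto simp: unit_cdf_def)
  interpret real_distribution \<mu> by fact
  show "0 \<le> H t" "H t \<le> 1"
    by (simp_all add: H cdf_nonneg cdf_bounded_prob)
qed

lemma unit_cdfI:
  assumes mono: "\<And>x y. x \<le> y \<Longrightarrow> H x \<le> H y"
    and right_cont: "\<And>x. continuous (at_right x) H"
    and left: "\<And>x. x < 0 \<Longrightarrow> H x = 0"
    and right: "\<And>x. x \<ge> 1 \<Longrightarrow> H x = 1"
  shows "unit_cdf H"
proof -
  let ?\<mu> = "interval_measure H"
  have bot: "(H \<longlongrightarrow> 0) at_bot"
    by (intro tendsto_eventually eventually_mono[OF eventually_gt_at_bot[of 0]] left)
  have top: "(H \<longlongrightarrow> 1) at_top"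
    by (intro tendsto_eventually eventually_mono[OF eventually_ge_at_top[of 1]] right)
  interpret real_distribution ?\<mu>
    using mono right_cont bot top by (rule real_distribution_interval_measure)
  have cdf: "cdf ?\<mu> = H"
    using mono right_cont bot by (rule cdf_interval_measure)
  have "(cdf ?\<mu> \<longlongrightarrow> 0) (at_left 0)"
    unfolding cdf by (rule tendsto_eventually) (auto simp: eventually_at_filter left)
  hence neg: "measure ?\<mu> {..<0} = 0"
    by (rule tendsto_unique[OF _ cdf_at_left, rotated]) simp
  have "cdf ?\<mu> 1 = measure ?\<mu> ({..<0} \<union> {0..1})"
    unfolding cdf_def by (rule arg_cong[where f = "measure ?\<mu>"]) auto
  also have "\<dots> = measure ?\<mu> {..<0} + measure ?\<mu> {0..1}"
    by (intro finite_measure_Union) auto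
  finally have "measure ?\<mu> {0..1} = 1"
    by (simp add: neg cdf right)
  thus ?thesis
    unfolding unit_cdf_def using real_distribution_axioms cdf by metis
qed

text \<open>
Raising a distribution function by a constant and cutting it off at 1 yields again a distribution
function, with an additional atom at 0. These raised functions are the competitors in Marshall's
lemma below.
\<close>

lemma unit_cdf_raise:
  assumes "real_distribution \<mu>" and one: "cdf \<mu> 1 = 1" and "0 \<le> e"
  shows "unit_cdf (\<lambda>t. if t < 0 then 0 else min (cdf \<mu> t + e) 1)"
proof (rule unit_cdfI)
  interpret real_distribution \<mu> by fact
  let ?H = "\<lambda>t. if t < 0 then 0 else min (cdf \<mu> t + e) 1"
  show "?H x \<le> ?H y" if "x \<le> y" for x y
    using that cdf_nondecreasing[OF that] cdf_nonneg[of y] \<open>0 \<le> e\<close> by auto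
  show "continuous (at_right x) ?H" for x
  proof (cases "x < 0")
    case True
    have "\<forall>\<^sub>F t in at_right x. 0 = ?H t"
      using True by (auto simp: eventually_at_right_field intro!: exI[of _ 0])
    thus ?thesis
      using True by (auto simp: continuous_within intro: tendsto_eventually elim: eventually_mono)
  next
    case False
    have "continuous (at_right x) (\<lambda>t. min (cdf \<mu> t + e) 1)"
      by (intro continuous_intros cdf_is_right_cont)
    hence "((\<lambda>t. min (cdf \<mu> t + e) 1) \<longlongrightarrow> ?H x) (at_right x)"
      using False by (simp add: continuous_within)
    moreover have "\<forall>\<^sub>F t in at_right x. min (cdf \<mu> t + e) 1 = ?H t"
      using False by (auto simp: eventually_at_filter)
    ultimately show ?thesis
      unfolding continuous_within by (rule Lim_transform_eventually)
  qed
  show "?H x = 1" if "x \<ge> 1" for x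
    using that one cdf_nondecreasing[OF that] \<open>0 \<le> e\<close> by auto
qed auto

lemma concave_on_min:
  assumes "concave_on S f" and "concave_on S g"
  shows "concave_on S (\<lambda>x. min (f x) (g x))"
  unfolding concave_on_iff
proof (intro conjI ballI allI impI)
  show "convex S"
    using assms(1) by (rule concave_on_imp_convex)
next
  fix x y and u v :: real
  assume *: "x \<in> S" "y \<in> S" "0 \<le> u" "0 \<le> v" "u + v = 1"
  have "u * min (f x) (g x) + v * min (f y) (g y) \<le> u * f x + v * f y"
    using * by (intro add_mono mult_left_mono) auto
  moreover have "u * min (f x) (g x) + v * min (f y) (g y) \<le> u * g x + v * g y"
    using * by (intro add_mono mult_left_mono) auto
  moreover have "u * f x + v * f y \<le> f (u *\<^sub>R x + v *\<^sub>R y)"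
    "u * g x + v * g y \<le> g (u *\<^sub>R x + v *\<^sub>R y)"
    using assms * by (auto simp: concave_on_iff)
  ultimately show "u * min (f x) (g x) + v * min (f y) (g y)
      \<le> min (f (u *\<^sub>R x + v *\<^sub>R y)) (g (u *\<^sub>R x + v *\<^sub>R y))"
    by linarith
qed

section \<open>Marshall's lemma\<close>

text \<open>
If \<open>E\<close> is within \<open>e\<close> of a concave distribution function \<open>C\<close>, then \<open>C\<close> raised by \<open>e\<close> and cut off
at 1 is a concave distribution function above \<open>E\<close>, so the least concave majorant of \<open>E\<close> exceeds
\<open>C\<close> by at most \<open>e\<close>; and it lies above \<open>E\<close>, hence above \<open>C - e\<close>. Only the values on the unit
interval matter, so \<open>C\<close> is linked to the distribution \<open>\<mu>\<close> there alone. The bound \<open>E \<le> 1\<close>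
makes the cut at 1 harmless.
\<close>

lemma least_concave_majorant_close:
  assumes "real_distribution \<mu>"
    and C: "\<And>t. t \<in> {0..1} \<Longrightarrow> cdf \<mu> t = C t"
    and "C 1 = 1" and conc: "concave_on {0..1} C"
    and E_le: "\<And>t. t \<in> {0..1} \<Longrightarrow> E t \<le> 1"
    and close: "\<And>t. t \<in> {0..1} \<Longrightarrow> \<bar>E t - C t\<bar> \<le> e"
    and t: "t \<in> {0..1}"
  shows "\<bar>least_concave_majorant E t - C t\<bar> \<le> e"
proof -
  define A where "A = {H. unit_cdf H \<and> concave_on {0..1} H \<and> (\<forall>s\<in>{0..1}. E s \<le> H s)}"
  define H where "H = (\<lambda>t. if t < 0 then 0 else min (cdf \<mu> t + e) 1)"
  have "0 \<le> e"
    using close[OF t] by linarith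
  have H_eq: "H s = min (C s + e) 1" if "s \<in> {0..1}" for s
    using that by (simp add: H_def C)
  have "concave_on {0..1} (\<lambda>s. min (C s + e) 1)"
    by (intro concave_on_min concave_on_add conc) (simp_all add: concave_on_const)
  hence "concave_on {0..1} H"
    by (auto simp: concave_on_iff H_eq convex_bound_le)
  moreover have "unit_cdf H"
    unfolding H_def using assms C[of 1] \<open>0 \<le> e\<close> by (intro unit_cdf_raise) auto
  moreover have "E s \<le> H s" if "s \<in> {0..1}" for s
    using close[OF that] E_le[OF that] by (simp add: H_eq[OF that])
  ultimately have "H \<in> A"
    by (simp add: A_def)
  have "bdd_below ((\<lambda>K. K t) ` A)"
    by (rule bdd_belowI2[of _ 0]) (auto simp: A_def unit_cdf_bounds)
  hence "least_concave_majorant E t \<le> H t"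
    unfolding least_concave_majorant_def A_def[symmetric] using \<open>H \<in> A\<close> by (rule cINF_lower)
  moreover have "E t \<le> least_concave_majorant E t"
    unfolding least_concave_majorant_def A_def[symmetric]
    using \<open>H \<in> A\<close> t by (intro cINF_greatest) (auto simp: A_def)
  ultimately show ?thesis
    using close[OF t] H_eq[OF t] by linarith
qed

section \<open>A strong law for bounded variables\<close>

text \<open>
By Hoeffding's inequality the average of \<open>m\<close> of the variables is off by \<open>e\<close> with probability at
most \<open>2 exp (-2 m e\<^sup>2)\<close>. This is a geometric series in \<open>m\<close>, so almost surely only finitely many
averages are off by \<open>e\<close>; intersecting over \<open>e = 1 / (k + 1)\<close> gives convergence.
\<close>

lemma (in prob_space) bounded_strong_law:
  fixes X :: "nat \<Rightarrow> 'a \<Rightarrow> real"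
  assumes indep: "indep_vars (\<lambda>_. borel) X {1..}"
    and bounds: "\<And>i. i \<ge> 1 \<Longrightarrow> AE \<omega> in M. X i \<omega> \<in> {0..1}"
    and mean: "\<And>i. i \<ge> 1 \<Longrightarrow> expectation (X i) = p"
  shows "AE \<omega> in M. (\<lambda>m. (\<Sum>i=1..m. X i \<omega>) / real m) \<longlonglongrightarrow> p"
proof -
  have meas [measurable]: "X i \<in> borel_measurable M" if "i \<ge> 1" for i
    using indep that by (auto simp: indep_vars_def)
  have sum_meas [measurable]: "(\<lambda>\<omega>. \<Sum>i=1..m. X i \<omega>) \<in> borel_measurable M" for m
    by (intro borel_measurable_sum meas) auto
  have ev: "AE \<omega> in M. \<forall>\<^sub>F m in sequentially. \<bar>(\<Sum>i=1..m. X i \<omega>) / real m - p\<bar> < e"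
    if "e > 0" for e
  proof -
    let ?B = "\<lambda>m. {\<omega>\<in>space M. \<bar>(\<Sum>i=1..Suc m. X i \<omega>) - real (Suc m) * p\<bar> \<ge> real (Suc m) * e}"
    have tail: "prob (?B m) \<le> 2 * exp (-2 * e\<^sup>2) ^ Suc m" for m
    proof -
      interpret Hoeffding_ineq M "{1..Suc m}" X "\<lambda>_. 0" "\<lambda>_. 1" "\<Sum>i=1..Suc m. expectation (X i)"
        by unfold_locales (use indep_vars_subset[OF indep] bounds in auto)
      have "prob (?B m) \<le> 2 * exp (-2 * (real (Suc m) * e)\<^sup>2 / real (Suc m))"
        using Hoeffding_ineq_abs_ge[of "real (Suc m) * e"] \<open>e > 0\<close> mean by simp
      also have "-2 * (real (Suc m) * e)\<^sup>2 / real (Suc m) = real (Suc m) * (-2 * e\<^sup>2)"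
        by (simp add: power2_eq_square)
      finally show ?thesis
        by (simp only: exp_of_nat_mult)
    qed
    have "summable (\<lambda>m. 2 * exp (-2 * e\<^sup>2) ^ Suc m)"
      using \<open>e > 0\<close> by (intro summable_mult summable_Suc_iff[THEN iffD2] summable_geometric) auto
    hence "summable (\<lambda>m. prob (?B m))"
      by (rule summable_comparison_test') (use tail in auto)
    hence "AE \<omega> in M. \<forall>\<^sub>F m in sequentially. \<omega> \<in> space M - ?B m"
      by (intro borel_cantelli_AE1) (auto simp: emeasure_eq_measure)
    thus ?thesis
    proof eventually_elim
      case (elim \<omega>)
      hence "\<forall>\<^sub>F m in sequentially. \<bar>(\<Sum>i=1..Suc m. X i \<omega>) / real (Suc m) - p\<bar> < e"
      proof eventually_elim
        case (elim m)
        have "(\<Sum>i=1..Suc m. X i \<omega>) / real (Suc m) - p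
            = ((\<Sum>i=1..Suc m. X i \<omega>) - real (Suc m) * p) / real (Suc m)"
          by (simp add: diff_divide_distrib)
        with elim show ?case
          by (simp add: abs_divide divide_less_eq mult.commute not_le del: sum.cl_ivl_Suc of_nat_Suc)
      qed
      thus ?case
        by (rule eventually_sequentially_Suc[THEN iffD1])
    qed
  qed
  have "AE \<omega> in M. \<forall>k. \<forall>\<^sub>F m in sequentially.
      \<bar>(\<Sum>i=1..m. X i \<omega>) / real m - p\<bar> < inverse (real (Suc k))"
    unfolding AE_all_countable by (intro allI ev) simp
  thus ?thesis
  proof eventually_elim
    case (elim \<omega>)
    show ?case
    proof (rule tendstoI)
      fix e :: real assume "e > 0"
      then obtain k where "inverse (real (Suc k)) < e"
        using reals_Archimedean by blast
      with elim[rule_format, of k]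
      show "\<forall>\<^sub>F m in sequentially. dist ((\<Sum>i=1..m. X i \<omega>) / real m) p < e"
        by (auto simp: dist_real_def elim: eventually_mono)
    qed
  qed
qed

section \<open>The Glivenko-Cantelli theorem on the unit interval\<close>

text \<open>
On a grid of step \<open>1 / N\<close> the convergence is uniform, as the grid is finite. Between two grid
points monotonicity traps \<open>f n\<close> between its values there, and uniform continuity keeps \<open>l\<close> nearly
constant.
\<close>

lemma uniform_limit_monotone_on_unit:
  fixes f :: "nat \<Rightarrow> real \<Rightarrow> real"
  assumes mono: "\<And>n. mono_on {0..1} (f n)" and cont: "continuous_on {0..1} l"
    and lim: "\<And>q. q \<in> \<rat> \<Longrightarrow> q \<in> {0..1} \<Longrightarrow> (\<lambda>n. f n q) \<longlonglongrightarrow> l q"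
  shows "uniform_limit {0..1} f l sequentially"
proof (rule uniform_limitI)
  fix e :: real assume "e > 0"
  have "uniformly_continuous_on {0..1} l"
    by (intro compact_uniformly_continuous cont) simp
  then obtain d where "d > 0"
    and d: "\<And>s t. s \<in> {0..1} \<Longrightarrow> t \<in> {0..1} \<Longrightarrow> \<bar>s - t\<bar> < d \<Longrightarrow> \<bar>l s - l t\<bar> < e / 2"
    unfolding uniformly_continuous_on_def dist_real_def using \<open>e > 0\<close> by (metis half_gt_zero)
  obtain k where "inverse (real (Suc k)) < d"
    using reals_Archimedean[OF \<open>d > 0\<close>] by blast
  define N where "N = real (Suc k)"
  have N: "N > 0" "1 / N < d"
    using \<open>inverse (real (Suc k)) < d\<close> by (auto simp: N_def inverse_eq_divide)
  have "\<forall>\<^sub>F n in sequentially. \<forall>j\<in>{..Suc k}. dist (f n (real j / N)) (l (real j / N)) < e / 2"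
  proof (intro eventually_ball_finite ballI finite_atMost)
    fix j assume "j \<in> {..Suc k}"
    hence "(\<lambda>n. f n (real j / N)) \<longlonglongrightarrow> l (real j / N)"
      by (intro lim) (auto simp: N_def)
    thus "\<forall>\<^sub>F n in sequentially. dist (f n (real j / N)) (l (real j / N)) < e / 2"
      using \<open>e > 0\<close> by (intro tendstoD) auto
  qed
  thus "\<forall>\<^sub>F n in sequentially. \<forall>t\<in>{0..1}. dist (f n t) (l t) < e"
  proof eventually_elim
    case (elim n)
    show ?case
    proof
      fix t :: real assume t: "t \<in> {0..1}"
      define i where "i = nat \<lfloor>t * N\<rfloor>"
      define j where "j = nat \<lceil>t * N\<rceil>"
      have tN: "0 \<le> t * N" "t * N \<le> N"
        using t N by (auto simp: mult_le_cancel_right1)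
      have i: "real i \<le> t * N" "t * N < real i + 1"
        using tN unfolding i_def by linarith+
      have j: "t * N \<le> real j" "real j < t * N + 1"
        using tN unfolding j_def by linarith+
      have "j \<le> Suc k"
        using tN unfolding j_def N_def by (simp add: ceiling_le_iff nat_le_iff)
      have "i \<le> j"
        using i j by linarith
      have le: "real i / N \<le> t" "t \<le> real j / N"
        using i j N by (auto simp: field_simps)
      have mem: "real i / N \<in> {0..1}" "real j / N \<in> {0..1}"
        using N \<open>j \<le> Suc k\<close> \<open>i \<le> j\<close> by (auto simp: N_def)
      have "t - real i / N = (t * N - real i) / N" "real j / N - t = (real j - t * N) / N"
        using N by (auto simp: field_simps)
      hence "t - real i / N < 1 / N" "real j / N - t < 1 / N"
        using i j N by (auto simp: divide_strict_right_mono)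
      hence near: "\<bar>l (real i / N) - l t\<bar> < e / 2" "\<bar>l (real j / N) - l t\<bar> < e / 2"
        by (intro d mem t; use le N in linarith)+
      have "f n (real i / N) \<le> f n t" "f n t \<le> f n (real j / N)"
        using mono[of n] mem t le by (auto simp: mono_on_def)
      moreover have "\<bar>f n (real i / N) - l (real i / N)\<bar> < e / 2"
        "\<bar>f n (real j / N) - l (real j / N)\<bar> < e / 2"
        using elim \<open>j \<le> Suc k\<close> \<open>i \<le> j\<close> by (auto simp: dist_real_def)
      ultimately show "dist (f n t) (l t) < e"
        using near unfolding dist_real_def by linarith
    qed
  qed
qed

lemma empirical_cdf_bounds: "0 \<le> empirical_cdf m x t" "empirical_cdf m x t \<le> 1"
proof -
  have "card {i \<in> {1..m}. x i \<le> t} \<le> card {1..m}"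
    by (intro card_mono) auto
  thus "empirical_cdf m x t \<le> 1"
    by (simp add: empirical_cdf_def divide_le_eq)
qed (simp add: empirical_cdf_def)

lemma mono_empirical_cdf: "mono (empirical_cdf m x)"
  unfolding empirical_cdf_def
  by (intro monoI divide_right_mono of_nat_mono card_mono) auto

lemma empirical_cdf_eq_average:
  "empirical_cdf m x t = (\<Sum>i=1..m. indicator {..t} (x i)) / real m"
  by (simp add: empirical_cdf_def indicator_def sum.If_cases Int_def)

lemma (in prob_space) glivenko_cantelli_unit:
  fixes P :: "nat \<Rightarrow> 'a \<Rightarrow> real"
  assumes indep: "indep_vars (\<lambda>_. borel) P {1..}"
    and cdf: "\<And>i t. i \<ge> 1 \<Longrightarrow> t \<in> {0..1} \<Longrightarrow> cdf (distr M borel (P i)) t = G t"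
    and cont: "continuous_on {0..1} G"
  shows "AE \<omega> in M. uniform_limit {0..1} (\<lambda>m. empirical_cdf m (\<lambda>i. P i \<omega>)) G sequentially"
proof -
  have meas [measurable]: "P i \<in> borel_measurable M" if "i \<ge> 1" for i
    using indep that by (auto simp: indep_vars_def)
  have pointwise: "AE \<omega> in M. (\<lambda>m. empirical_cdf m (\<lambda>i. P i \<omega>) t) \<longlonglongrightarrow> G t"
    if t: "t \<in> {0..1}" for t
    unfolding empirical_cdf_eq_average
  proof (rule bounded_strong_law)
    show "indep_vars (\<lambda>_. borel) (\<lambda>i \<omega>. indicator {..t} (P i \<omega>) :: real) {1..}"
      by (intro indep_vars_compose2[OF indep]) auto
    show "expectation (\<lambda>\<omega>. indicator {..t} (P i \<omega>)) = G t" if "i \<ge> 1" for i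
    proof -
      have "expectation (\<lambda>\<omega>. indicat_real {..t} (P i \<omega>))
          = (\<integral>x. indicat_real {..t} x \<partial>distr M borel (P i))"
        by (rule integral_distr[symmetric]) (use that in auto)
      also have "\<dots> = cdf (distr M borel (P i)) t"
        by (simp add: cdf_def)
      finally show ?thesis
        using cdf[OF that t] by simp
    qed
  qed (auto simp: indicator_def)
  have "AE \<omega> in M. \<forall>q\<in>\<rat> \<inter> {0..1}. (\<lambda>m. empirical_cdf m (\<lambda>i. P i \<omega>) q) \<longlonglongrightarrow> G q"
    by (subst AE_ball_countable) (auto intro: countable_rat pointwise)
  thus ?thesis
  proof eventually_elim
    case (elim \<omega>)
    show ?case
      by (rule uniform_limit_monotone_on_unit)
         (use elim cont mono_empirical_cdf in \<open>auto intro: mono_imp_mono_on\<close>)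
  qed
qed

lemma (in prob_space) isCont_cdf_of_density:
  assumes "distributed M lborel X f"
  shows "isCont (cdf (distr M borel X)) x"
proof -
  have [measurable]: "X \<in> borel_measurable M"
    using distributed_measurable[OF assms] by simp
  interpret D: real_distribution "distr M borel X"
    by simp
  have "distr M borel X = density lborel f"
    using distributed_distr_eq_density[OF assms]
    by (metis distr_cong sets_lborel)
  moreover have "emeasure (density lborel f) {x} = 0"
    using distributed_borel_measurable[OF assms]
    by (subst emeasure_density) (auto simp: nn_integral_0_iff_AE
        intro!: eventually_mono[OF AE_lborel_singleton[of x]])
  ultimately have "measure (distr M borel X) {x} = 0"
    by (simp add: measure_def)
  thus ?thesis
    by (simp only: D.isCont_cdf)
qed

section \<open>Consistency of the minimum distance estimator\<close>

theorem theorem3p4: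
  fixes M :: "'a measure"
    and P :: "nat \<Rightarrow> 'a \<Rightarrow> real"
    and a :: real
    and \<F> :: "(real \<Rightarrow> real) set"
    and F G g :: "real \<Rightarrow> real"
    and Ghat :: "nat \<Rightarrow> 'a \<Rightarrow> real \<Rightarrow> real"
  assumes "prob_space M"
    and "0 < a" and "a \<le> 1"
    and "\<And>H. H \<in> \<F> \<Longrightarrow> unit_cdf H"
    and "\<And>H t. H \<in> \<F> \<Longrightarrow> t \<in> {0..1} \<Longrightarrow> t \<le> H t"
    and "F \<in> \<F>"
    and "\<And>t. t \<in> {0..1} \<Longrightarrow> G t = (1 - a) * t + a * F t"
    and "prob_space.indep_vars M (\<lambda>_. borel) P {1..}"
    and "\<And>i t. i \<ge> 1 \<Longrightarrow> t \<in> {0..1} \<Longrightarrow> cdf (distr M borel (P i)) t = G t"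
    and "\<And>i. i \<ge> 1 \<Longrightarrow> distributed M lborel (P i) (\<lambda>t. ennreal (g t * indicator {0..1} t))"
    and "AE t in lborel. t \<in> {0<..<1} \<longrightarrow> (G has_real_derivative g t) (at t)"
    and "Ghat = G_hat P \<or> (concave_on {0..1} G \<and> Ghat = G_hat_concave P)"
  shows "(\<forall>m\<ge>1. \<forall>\<omega>\<in>space M. \<forall>Fhat.
            is_arg_min (\<lambda>H. unit_supnorm (\<lambda>t. Ghat m \<omega> t - (1 - a) * t - a * H t))
              (\<lambda>H. H \<in> \<F>) Fhat \<longrightarrow>
            unit_supnorm (\<lambda>t. F t - Fhat t) \<le> 2 * unit_supnorm (\<lambda>t. G t - Ghat m \<omega> t) / a)
       \<and> (AE \<omega> in M. (\<lambda>m. 2 * unit_supnorm (\<lambda>t. G t - Ghat m \<omega> t) / a) \<longlonglongrightarrow> 0)"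
proof -
  interpret prob_space M by fact
  let ?E = "\<lambda>m \<omega>. empirical_cdf m (\<lambda>i. P i \<omega>)"
  let ?\<mu> = "distr M borel (P 1)"
  note F_in = \<open>F \<in> \<F>\<close> and G_eq = assms(7) and G_cdf = assms(9) and dens = assms(10)
  have [measurable]: "P 1 \<in> borel_measurable M"
    using distributed_measurable[OF dens[of 1]] by simp
  interpret D: real_distribution ?\<mu>
    by (rule real_distribution_distr) measurable
  have cdf1: "cdf ?\<mu> t = G t" if "t \<in> {0..1}" for t
    using G_cdf[of 1 t] that by simp
  have G_bounds: "0 \<le> G t" "G t \<le> 1" if "t \<in> {0..1}" for t
    using cdf1[OF that] D.cdf_nonneg[of t] D.cdf_bounded_prob[of t] by simp_all
  have G_ge: "t \<le> G t" if "t \<in> {0..1}" for t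
  proof -
    have "a * t \<le> a * F t"
      using assms(2) assms(5)[OF F_in that] by simp
    thus ?thesis
      by (simp add: G_eq[OF that] algebra_simps)
  qed
  have "G 1 = 1"
    using G_ge[of 1] G_bounds(2)[of 1] by simp

  have no_farther: "\<bar>G t - Ghat m \<omega> t\<bar> \<le> e"
    if "\<And>s. s \<in> {0..1} \<Longrightarrow> \<bar>?E m \<omega> s - G s\<bar> \<le> e" "t \<in> {0..1}" for m \<omega> e t
  proof -
    have max_le: "\<bar>G t - max y t\<bar> \<le> e" if "\<bar>y - G t\<bar> \<le> e" for y
      using that G_ge[OF \<open>t \<in> {0..1}\<close>] by linarith
    from assms(12) show ?thesis
    proof
      assume "Ghat = G_hat P"
      thus ?thesis
        using that by (auto simp: G_hat_def intro!: max_le)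
    next
      assume conc: "concave_on {0..1} G \<and> Ghat = G_hat_concave P"
      have "\<bar>least_concave_majorant (?E m \<omega>) t - G t\<bar> \<le> e"
      proof (rule least_concave_majorant_close)
        show "real_distribution ?\<mu>"
          by (rule D.real_distribution_axioms)
      qed (use conc cdf1 \<open>G 1 = 1\<close> that empirical_cdf_bounds in auto)
      thus ?thesis
        using conc by (auto simp: G_hat_concave_def intro!: max_le)
    qed
  qed

  have "unit_supnorm (\<lambda>t. F t - Fhat t) \<le> 2 * unit_supnorm (\<lambda>t. G t - Ghat m \<omega> t) / a"
    if arg_min: "is_arg_min (\<lambda>H. unit_supnorm (\<lambda>t. Ghat m \<omega> t - (1 - a) * t - a * H t))
        (\<lambda>H. H \<in> \<F>) Fhat" for m \<omega> Fhat
  proof -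
    let ?R = "\<lambda>H t. Ghat m \<omega> t - (1 - a) * t - a * H t"
    define d where "d = unit_supnorm (\<lambda>t. G t - Ghat m \<omega> t)"
    have Fhat_in: "Fhat \<in> \<F>" and min: "unit_supnorm (?R Fhat) \<le> unit_supnorm (?R F)"
      using arg_min F_in by (auto simp: is_arg_min_def not_less)
    have far: "\<bar>G t - Ghat m \<omega> t\<bar> \<le> 1" if "t \<in> {0..1}" for t
    proof (rule no_farther)
      show "\<bar>?E m \<omega> s - G s\<bar> \<le> 1" if "s \<in> {0..1}" for s
        using G_bounds[OF that] empirical_cdf_bounds[where m=m and x="\<lambda>i. P i \<omega>" and t=s] by linarith
    qed fact
    have close: "\<bar>G t - Ghat m \<omega> t\<bar> \<le> d" if "t \<in> {0..1}" for t
      unfolding d_def using far that by (rule abs_le_unit_supnorm)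
    have "unit_supnorm (?R F) \<le> d"
    proof (rule unit_supnorm_le)
      show "\<bar>?R F t\<bar> \<le> d" if "t \<in> {0..1}" for t
        using close[OF that] by (simp add: G_eq[OF that])
    qed
    have R_eq: "?R Fhat t = a * (F t - Fhat t) - (G t - Ghat m \<omega> t)" if "t \<in> {0..1}" for t
      by (simp add: G_eq[OF that] algebra_simps)
    \<comment> \<open>The real supremum dominates the values of the residual only once that residual is known to
      be bounded; the size of the bound is immaterial.\<close>
    have R_bounded: "\<bar>?R Fhat t\<bar> \<le> a + 1" if "t \<in> {0..1}" for t
    proof -
      have "\<bar>F t - Fhat t\<bar> \<le> 1"
        using unit_cdf_bounds[OF assms(4)[OF F_in], of t]
          unit_cdf_bounds[OF assms(4)[OF Fhat_in], of t] by linarith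
      hence "\<bar>a * (F t - Fhat t)\<bar> \<le> a"
        using assms(2) by (simp add: abs_mult)
      thus ?thesis
        unfolding R_eq[OF that] using far[OF that] by linarith
    qed
    have "\<bar>F t - Fhat t\<bar> \<le> 2 * d / a" if "t \<in> {0..1}" for t
    proof -
      have "\<bar>?R Fhat t\<bar> \<le> unit_supnorm (?R Fhat)"
        using R_bounded that by (rule abs_le_unit_supnorm)
      hence "\<bar>a * (F t - Fhat t)\<bar> \<le> 2 * d"
        using R_eq[OF that] close[OF that] min \<open>unit_supnorm (?R F) \<le> d\<close> by linarith
      thus ?thesis
        using assms(2) by (simp add: abs_mult pos_le_divide_eq mult.commute)
    qed
    thus ?thesis
      unfolding d_def by (rule unit_supnorm_le)
  qed
  moreover have "AE \<omega> in M. (\<lambda>m. 2 * unit_supnorm (\<lambda>t. G t - Ghat m \<omega> t) / a) \<longlonglongrightarrow> 0"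
  proof -
    have "continuous_on {0..1} (cdf ?\<mu>)"
      using isCont_cdf_of_density[OF dens[of 1]] by (auto intro: continuous_at_imp_continuous_on)
    hence "continuous_on {0..1} G"
      by (rule continuous_on_eq) (rule cdf1)
    with assms(8) G_cdf
    have "AE \<omega> in M. uniform_limit {0..1} (\<lambda>m. ?E m \<omega>) G sequentially"
      by (rule glivenko_cantelli_unit)
    thus ?thesis
    proof eventually_elim
      case (elim \<omega>)
      have "uniform_limit {0..1} (\<lambda>m. Ghat m \<omega>) G sequentially"
      proof (rule uniform_limitI)
        fix e :: real assume "e > 0"
        hence "e / 2 > 0" by simp
        with elim have "\<forall>\<^sub>F m in sequentially. \<forall>t\<in>{0..1}. dist (?E m \<omega> t) (G t) < e / 2"
          by (rule uniform_limitD)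
        thus "\<forall>\<^sub>F m in sequentially. \<forall>t\<in>{0..1}. dist (Ghat m \<omega> t) (G t) < e"
        proof eventually_elim
          case (elim m)
          have "\<bar>G t - Ghat m \<omega> t\<bar> \<le> e / 2" if "t \<in> {0..1}" for t
            by (rule no_farther) (use elim that in \<open>auto simp: dist_real_def less_imp_le\<close>)
          thus ?case
            using \<open>e > 0\<close> by (force simp: dist_real_def abs_minus_commute)
        qed
      qed
      from tendsto_mult_right_zero[OF unit_supnorm_tendsto_0[OF this], of "2 / a"]
      show ?case
        by simp
    qed
  qed
  ultimately show ?thesis
    by blast
qed

end
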